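(* Let $\mathcal{V}=\mathcal{B}=\textsc{Gs}$ and consider any declared welfare maximizer mechanism. Then for every $\gamma\ge 0$, $\textsc{PoA}_\gamma\le 4+2\gamma$. That is, for every profile $\mathbf{v}\in\textsc{Gs}^n$ of true valuations and every pure Nash equilibrium $\mathbf{b}\in\textsc{Gs}^n$ in which every agent's strategy $b_i$ has exposure factor $\gamma$, $\sum_i v_i(\mathbf{x}^*_i)\le(4+2\gamma)\sum_i v_i(\mathbf{x}_i(\mathbf{b}))$, where $(\mathbf{x}^*_i)_i$ is a partition of the items maximizing $\sum_i v_i(\mathbf{x}^*_i)$.
   Context: There are $m$ items and $n$ agents. A valuation is $v:\{0,1\}^m\to\mathbb{R}_+$ with $v(\mathbf{0})=0$ and monotone. Demand at prices $\mathbf{p}$: $D_v(\mathbf{p})=\arg\max_{\mathbf{x}\in\{0,1\}^m}[v(\mathbf{x})-\mathbf{p}\cdot\mathbf{x}]$. $v\in\textsc{Gs}$ (gross substitutes) if for all prices $\mathbf{p}\le\mathbf{q}$, $S=\{j:p_j=q_j\}$, and $\mathbf{x}\in D_v(\mathbf{p})$, there is $\mathbf{y}\in D_v(\mathbf{q})$ with $y_j\ge x_j$ for all $j\in S$. A mechanism with bidding space $\mathcal{B}$ consists of allocation maps $\mathbf{x}_i:\mathcal{B}^n\to\{0,1\}^m$ with $\sum_i\mathbf{x}_i(\mathbf{b})\le\mathbf{1}$ and payment maps $\pi_i:\mathcal{B}^n\to\mathbb{R}_+$; utility is $u_i(v_i;\mathbf{b})=v_i(\mathbf{x}_i(\mathbf{b}))-\pi_i(\mathbf{b})$.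 It is a declared welfare maximizer if $\mathbf{x}_1(\mathbf{b}),\dots,\mathbf{x}_n(\mathbf{b})$ is a partition of the items maximizing $\sum_i b_i(\mathbf{x}_i)$, and (i) $\pi_i(\mathbf{b})\le b_i(\mathbf{x}_i(\mathbf{b}))$ for all $\mathbf{b}$, $i$; (ii) for every $\mathbf{b}$ and $i$ there is $\mathbf{b}'_{-i}$ with $\mathbf{x}_i(b_i,\mathbf{b}'_{-i})=\mathbf{x}_i(\mathbf{b})$ and $\pi_i(b_i,\mathbf{b}'_{-i})=b_i(\mathbf{x}_i(\mathbf{b}))$. A strategy $b_i$ has exposure factor $\gamma$ (for true valuation $v_i$) if $\pi_i(b_i,\mathbf{b}_{-i})\le(1+\gamma)v_i(\mathbf{x}_i(b_i,\mathbf{b}_{-i}))$ for all $\mathbf{b}_{-i}\in\mathcal{B}^{n-1}$. A pure Nash equilibrium is $\mathbf{b}\in\mathcal{B}^n$ with $u_i(v_i;\mathbf{b})\ge u_i(v_i;b_i',\mathbf{b}_{-i})$ for all $i$, $b_i'\in\mathcal{B}$. $\textsc{PoA}_\gamma$ is the maximum over $\mathbf{v}\in\mathcal{V}^n$ and over pure Nash equilibria in which all strategies have exposure factor $\gamma$ of the ratio of optimal welfare to equilibrium welfare (defined as $1$ if no such equilibrium exists). *)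

theory Defs
  imports Main "HOL-Library.FuncSet" Complex_Main
begin

(* Items are 0..m-1, agents are 0..n-1. A bundle x in {0,1}^m is represented by the
  set of items it contains, a subset of {..<m}. A valuation / bid is a function on bundles.
  A price vector is a function from items to reals. *)

type_synonym itemset = "nat set"
type_synonym valuation = "nat set \<Rightarrow> real"
type_synonym profile = "nat \<Rightarrow> valuation"

definition is_valuation :: "nat \<Rightarrow> valuation \<Rightarrow> bool" where
  "is_valuation m v \<longleftrightarrow> v {} = 0 \<and> (\<forall>S. S \<subseteq> {..<m} \<longrightarrow> 0 \<le> v S) \<and>
     (\<forall>S T. S \<subseteq> T \<longrightarrow> T \<subseteq> {..<m} \<longrightarrow> v S \<le> v T)"

definition demand :: "nat \<Rightarrow> valuation \<Rightarrow> (nat \<Rightarrow> real) \<Rightarrow> itemset set" where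
  "demand m v p = {x. x \<subseteq> {..<m} \<and>
     (\<forall>y. y \<subseteq> {..<m} \<longrightarrow> v y - (\<Sum>j\<in>y. p j) \<le> v x - (\<Sum>j\<in>x. p j))}"

definition GS :: "nat \<Rightarrow> valuation set" where
  "GS m = {v. is_valuation m v \<and>
     (\<forall>p q. (\<forall>j<m. p j \<le> q j) \<longrightarrow>
        (\<forall>x\<in>demand m v p. \<exists>y\<in>demand m v q. x \<inter> {j. j < m \<and> p j = q j} \<subseteq> y))}"

(* Bid profiles in B^n (coordinates \<ge> n are irrelevant). *)
definition valid_profile :: "nat \<Rightarrow> nat \<Rightarrow> profile \<Rightarrow> bool" where
  "valid_profile m n b \<longleftrightarrow> (\<forall>i<n. b i \<in> GS m)"

definition is_partition :: "nat \<Rightarrow> nat \<Rightarrow> (nat \<Rightarrow> itemset) \<Rightarrow> bool" where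
  "is_partition m n X \<longleftrightarrow> (\<forall>i<n. X i \<subseteq> {..<m}) \<and>
     (\<forall>i<n. \<forall>k<n. i \<noteq> k \<longrightarrow> X i \<inter> X k = {}) \<and> (\<Union>i<n. X i) = {..<m}"

definition welfare :: "nat \<Rightarrow> profile \<Rightarrow> (nat \<Rightarrow> itemset) \<Rightarrow> real" where
  "welfare n v X = (\<Sum>i<n. v i (X i))"

definition optimal_partition :: "nat \<Rightarrow> nat \<Rightarrow> profile \<Rightarrow> (nat \<Rightarrow> itemset) \<Rightarrow> bool" where
  "optimal_partition m n v X \<longleftrightarrow> is_partition m n X \<and>
     (\<forall>Y. is_partition m n Y \<longrightarrow> welfare n v Y \<le> welfare n v X)"

definition declared_welfare_maximizer ::
  "nat \<Rightarrow> nat \<Rightarrow> (profile \<Rightarrow> nat \<Rightarrow> itemset) \<Rightarrow> (profile \<Rightarrow> nat \<Rightarrow> real) \<Rightarrow> bool" where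
  "declared_welfare_maximizer m n alloc pay \<longleftrightarrow>
     (\<forall>b. valid_profile m n b \<longrightarrow>
        optimal_partition m n b (alloc b) \<and>
        (\<forall>i<n. 0 \<le> pay b i \<and> pay b i \<le> b i (alloc b i)) \<and>
        (\<forall>i<n. \<exists>b'. valid_profile m n b' \<and> b' i = b i \<and>
              alloc b' i = alloc b i \<and> pay b' i = b i (alloc b i)))"

definition utility ::
  "(profile \<Rightarrow> nat \<Rightarrow> itemset) \<Rightarrow> (profile \<Rightarrow> nat \<Rightarrow> real) \<Rightarrow> valuation \<Rightarrow> nat \<Rightarrow> profile \<Rightarrow> real" where
  "utility alloc pay v i b = v (alloc b i) - pay b i"

definition has_exposure ::
  "nat \<Rightarrow> nat \<Rightarrow> (profile \<Rightarrow> nat \<Rightarrow> itemset) \<Rightarrow> (profile \<Rightarrow> nat \<Rightarrow> real) \<Rightarrow>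
   real \<Rightarrow> valuation \<Rightarrow> nat \<Rightarrow> valuation \<Rightarrow> bool" where
  "has_exposure m n alloc pay \<gamma> v i bi \<longleftrightarrow>
     (\<forall>b. valid_profile m n b \<longrightarrow> b i = bi \<longrightarrow> pay b i \<le> (1 + \<gamma>) * v (alloc b i))"

definition pure_nash ::
  "nat \<Rightarrow> nat \<Rightarrow> (profile \<Rightarrow> nat \<Rightarrow> itemset) \<Rightarrow> (profile \<Rightarrow> nat \<Rightarrow> real) \<Rightarrow>
   profile \<Rightarrow> profile \<Rightarrow> bool" where
  "pure_nash m n alloc pay v b \<longleftrightarrow> valid_profile m n b \<and>
     (\<forall>i<n. \<forall>bi'\<in>GS m. utility alloc pay (v i) i (b(i := bi')) \<le> utility alloc pay (v i) i b)"

end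

theory Submission
  imports Defs "HOL-Library.Disjoint_Sets"
begin

text \<open>Let \<open>W I T\<close> be the optimal declared welfare of the agents \<open>I\<close> on the items \<open>T\<close>, and \<open>N\<close>, \<open>M\<close>
  the sets of all agents and items. If agent \<open>i\<close> deviates to half her true valuation, she keeps at
  least half the value of what she wins, so declared optimality and the equilibrium condition give
  \<open>v i (Xopt i) / 2 - (W (N - {i}) M - W (N - {i}) (M - Xopt i)) \<le> u i\<close>.
  The optimal welfare \<open>W I\<close> is submodular in the items. Hence the losses only grow when \<open>i\<close> is added
  to the agents, and the sum of \<open>W N M - W N (M - Xopt i)\<close> over all \<open>i\<close> is at most \<open>W N M\<close>, which
  is at most \<open>1 + \<gamma>\<close> times the equilibrium welfare by the exposure bound.

  Submodularity of \<open>W I\<close> comes from duality: \<open>W I T\<close> is the minimum over prices \<open>p\<close> of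
  \<open>U p + p(T)\<close>, where \<open>U\<close> is the sum of the indirect utilities, and gross substitutes makes \<open>U\<close>
  submodular in the prices. Up to an arbitrarily small error, the minimum is attained by the
  final prices of an ascending auction.\<close>

section \<open>Indirect utility and demand\<close>

definition indirect_utility :: "nat \<Rightarrow> valuation \<Rightarrow> (nat \<Rightarrow> real) \<Rightarrow> real" where
  "indirect_utility m v p = Max ((\<lambda>S. v S - sum p S) ` Pow {..<m})"

lemma indirect_utility_ge:
  assumes "S \<subseteq> {..<m}"
  shows "v S - sum p S \<le> indirect_utility m v p"
  unfolding indirect_utility_def using assms by (intro Max_ge) auto

lemma indirect_utility_attained:
  obtains S where "S \<subseteq> {..<m}" "indirect_utility m v p = v S - sum p S"
proof -
  have "Max ((\<lambda>S. v S - sum p S) ` Pow {..<m}) \<in> (\<lambda>S. v S - sum p S) ` Pow {..<m}"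
    by (intro Max_in) auto
  then show thesis
    using that by (auto simp: indirect_utility_def)
qed

lemma indirect_utility_cong:
  assumes "\<And>j. j < m \<Longrightarrow> p j = q j"
  shows "indirect_utility m v p = indirect_utility m v q"
  unfolding indirect_utility_def
proof (intro arg_cong[where f = Max] image_cong refl)
  fix S assume "S \<in> Pow {..<m}"
  then have "sum p S = sum q S"
    using assms by (intro sum.cong) auto
  then show "v S - sum p S = v S - sum q S" by simp
qed

lemma mem_demand_iff:
  "x \<in> demand m v p \<longleftrightarrow> x \<subseteq> {..<m} \<and> v x - sum p x = indirect_utility m v p"
proof
  assume x: "x \<in> demand m v p"
  obtain S where "S \<subseteq> {..<m}" "indirect_utility m v p = v S - sum p S"
    by (rule indirect_utility_attained)
  with x show "x \<subseteq> {..<m} \<and> v x - sum p x = indirect_utility m v p"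
    using indirect_utility_ge[of x m v p] by (auto simp: demand_def intro: antisym)
next
  assume "x \<subseteq> {..<m} \<and> v x - sum p x = indirect_utility m v p"
  then show "x \<in> demand m v p"
    using indirect_utility_ge[of _ m v p] by (auto simp: demand_def)
qed

lemma demand_nonempty: "\<exists>x. x \<in> demand m v p"
  by (metis indirect_utility_attained mem_demand_iff)

text \<open>Dropping \<open>j\<close> from a demanded bundle saves \<open>p j\<close> and forfeits
  at most \<open>v {..<m}\<close>. This bounds the prices that the auction can reach.\<close>

lemma demanded_price_le:
  assumes v: "is_valuation m v" and x: "x \<in> demand m v p" and j: "j \<in> x"
  shows "p j \<le> v {..<m}"
proof -
  have xs: "x \<subseteq> {..<m}" using x by (simp add: demand_def)
  then have fin: "finite x" using finite_subset by blast
  have "v (x - {j}) - sum p (x - {j}) \<le> v x - sum p x"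
    using x xs unfolding demand_def by blast
  moreover have "sum p x = p j + sum p (x - {j})"
    using fin j by (rule sum.remove)
  moreover have "0 \<le> v (x - {j})" "v x \<le> v {..<m}"
    using v xs Diff_subset[of x "{j}"] unfolding is_valuation_def by (metis order_trans order_refl)+
  ultimately show ?thesis by linarith
qed

section \<open>Gross substitutes: scaling, and submodularity of the indirect utility in the
  prices\<close>

lemma GS_is_valuation: "v \<in> GS m \<Longrightarrow> is_valuation m v"
  by (simp add: GS_def)

lemma GS_substitutes:
  assumes "v \<in> GS m" "\<And>j. j < m \<Longrightarrow> p j \<le> q j" "x \<in> demand m v p"
  obtains y where "y \<in> demand m v q" "\<And>j. j \<in> x \<Longrightarrow> j < m \<Longrightarrow> p j = q j \<Longrightarrow> j \<in> y"
proof -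
  obtain y where "y \<in> demand m v q" "x \<inter> {j. j < m \<and> p j = q j} \<subseteq> y"
    using assms unfolding GS_def by blast
  then show thesis using that by blast
qed

text \<open>The demand of \<open>c * v\<close> at prices \<open>p\<close> is that of
  \<open>v\<close> at prices \<open>p / c\<close>. With \<open>c = 1/2\<close> this makes the
  half-value deviation a legal bid.\<close>

lemma scale_mem_GS:
  assumes v: "v \<in> GS m" and c: "0 < c"
  shows "(\<lambda>S. c * v S) \<in> GS m"
proof -
  have *: "demand m (\<lambda>S. c * v S) p = demand m v (\<lambda>j. p j / c)" for p
  proof -
    have "c * v y - sum p y \<le> c * v x - sum p x \<longleftrightarrow>
        v y - (\<Sum>j\<in>y. p j / c) \<le> v x - (\<Sum>j\<in>x. p j / c)" for x y
    proof -
      have "c * v z - sum p z = c * (v z - (\<Sum>j\<in>z. p j / c))" for z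
        using c by (simp add: sum_divide_distrib[symmetric] field_simps)
      then show ?thesis using c by simp
    qed
    then show ?thesis by (simp add: demand_def)
  qed
  have "is_valuation m (\<lambda>S. c * v S)"
    using GS_is_valuation[OF v] c by (auto simp: is_valuation_def)
  moreover have "\<exists>y\<in>demand m (\<lambda>S. c * v S) q. x \<inter> {j. j < m \<and> p j = q j} \<subseteq> y"
    if pq: "\<forall>j<m. p j \<le> q j" and x: "x \<in> demand m (\<lambda>S. c * v S) p" for p q x
  proof -
    obtain y where "y \<in> demand m v (\<lambda>j. q j / c)"
      "\<And>j. j \<in> x \<Longrightarrow> j < m \<Longrightarrow> p j / c = q j / c \<Longrightarrow> j \<in> y"
    proof (rule GS_substitutes[OF v])
      show "p j / c \<le> q j / c" if "j < m" for j using pq that c by (simp add: divide_right_mono)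
      show "x \<in> demand m v (\<lambda>j. p j / c)" using x by (simp add: *)
    qed blast
    then show ?thesis unfolding * by auto
  qed
  ultimately show ?thesis by (simp add: GS_def)
qed

text \<open>As a function of the price \<open>x\<close> of item \<open>a\<close> alone, the indirect utility is
  \<open>max (A - x) B\<close>, and gross substitutes says exactly that the threshold \<open>A - B\<close> increases
  with the other prices.\<close>

lemma indirect_utility_decreasing_differences:
  assumes v: "v \<in> GS m" and pq: "\<And>j. j < m \<Longrightarrow> p j \<le> q j" and a: "a < m" "p a = q a" "p a \<le> t"
  shows "indirect_utility m v (q(a := t)) - indirect_utility m v q
    \<le> indirect_utility m v (p(a := t)) - indirect_utility m v p"
proof -
  \<comment> \<open>\<open>A r\<close> and \<open>B r\<close> are the best values with and without
    \<open>a\<close>, net of the prices of the other items; neither depends on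
    \<open>r a\<close>.\<close>
  define \<W> where "\<W> = {S. S \<subseteq> {..<m} \<and> a \<in> S}"
  define \<N> where "\<N> = {S. S \<subseteq> {..<m} \<and> a \<notin> S}"
  define A where "A r = Max ((\<lambda>S. v S - sum r (S - {a})) ` \<W>)" for r
  define B where "B r = Max ((\<lambda>S. v S - sum r S) ` \<N>)" for r
  have fin: "finite \<W>" "finite \<N>"
    by (auto simp: \<W>_def \<N>_def intro: finite_subset[of _ "Pow {..<m}"])
  have ne: "\<W> \<noteq> {}" "\<N> \<noteq> {}"
    using a by (auto simp: \<W>_def \<N>_def)
  have A_ge: "v S - sum r (S - {a}) \<le> A r" if "S \<in> \<W>" for S r
    unfolding A_def using that fin by (intro Max_ge) auto
  have B_ge: "v S - sum r S \<le> B r" if "S \<in> \<N>" for S r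
    unfolding B_def using that fin by (intro Max_ge) auto
  have A_att: "\<exists>S\<in>\<W>. A r = v S - sum r (S - {a})" for r
  proof -
    have "A r \<in> (\<lambda>S. v S - sum r (S - {a})) ` \<W>"
      unfolding A_def using fin ne by (intro Max_in) auto
    then show ?thesis by blast
  qed
  have B_att: "\<exists>S\<in>\<N>. B r = v S - sum r S" for r
  proof -
    have "B r \<in> (\<lambda>S. v S - sum r S) ` \<N>"
      unfolding B_def using fin ne by (intro Max_in) auto
    then show ?thesis by blast
  qed
  have sum_W: "sum (r(a := x)) S = x + sum r (S - {a})" if "S \<in> \<W>" for r x S
  proof -
    have "finite S" "a \<in> S" using that finite_subset by (auto simp: \<W>_def)
    then have "sum (r(a := x)) S = x + sum (r(a := x)) (S - {a})"
      by (simp add: sum.remove)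
    then show ?thesis by simp
  qed
  have sum_N: "sum (r(a := x)) S = sum r S" if "S \<in> \<N>" for r x S
    using that by (intro sum.cong) (auto simp: \<N>_def)
  have u: "indirect_utility m v (r(a := x)) = max (A r - x) (B r)" for r x
  proof (rule antisym)
    obtain S where S: "S \<subseteq> {..<m}" "indirect_utility m v (r(a := x)) = v S - sum (r(a := x)) S"
      by (rule indirect_utility_attained)
    show "indirect_utility m v (r(a := x)) \<le> max (A r - x) (B r)"
    proof (cases "a \<in> S")
      case True
      then have "S \<in> \<W>" using S by (simp add: \<W>_def)
      then show ?thesis using A_ge[of S r] sum_W[of S r x] S by auto
    next
      case False
      then have "S \<in> \<N>" using S by (simp add: \<N>_def)
      then show ?thesis using B_ge[of S r] sum_N[of S r x] S by auto
    qed
    obtain S1 where S1: "S1 \<in> \<W>" "A r = v S1 - sum r (S1 - {a})" using A_att by blast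
    obtain S2 where S2: "S2 \<in> \<N>" "B r = v S2 - sum r S2" using B_att by blast
    show "max (A r - x) (B r) \<le> indirect_utility m v (r(a := x))"
      using S1 S2 sum_W[of S1 r x] sum_N[of S2 r x]
        indirect_utility_ge[of S1 m v "r(a := x)"] indirect_utility_ge[of S2 m v "r(a := x)"]
      by (auto simp: \<W>_def \<N>_def)
  qed
  have threshold: "A p - B p \<le> A q - B q"
  proof (rule ccontr)
    assume "\<not> ?thesis"
    \<comment> \<open>At a price \<open>x\<close> of \<open>a\<close> strictly between the two
      thresholds, \<open>a\<close> lies in every bundle demanded at \<open>p(a := x)\<close> and in
      none demanded at \<open>q(a := x)\<close>. As the price of \<open>a\<close> is the same in
      both, this contradicts gross substitutes.\<close>
    then obtain x where x: "A q - B q < x" "x < A p - B p"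
      using dense[of "A q - B q" "A p - B p"] by auto
    obtain S where S: "S \<in> demand m v (p(a := x))" using demand_nonempty by blast
    have "a \<in> S"
    proof (rule ccontr)
      assume "a \<notin> S"
      then have "S \<in> \<N>" using S by (simp add: \<N>_def demand_def)
      then have "indirect_utility m v (p(a := x)) \<le> B p"
        using S B_ge[of S p] sum_N[of S p x] by (simp add: mem_demand_iff)
      then show False using x u[of p x] by simp
    qed
    obtain S' where S': "S' \<in> demand m v (q(a := x))"
      "\<And>j. j \<in> S \<Longrightarrow> j < m \<Longrightarrow> (p(a := x)) j = (q(a := x)) j \<Longrightarrow> j \<in> S'"
    proof (rule GS_substitutes[OF v _ S, of "q(a := x)"])
      show "(p(a := x)) j \<le> (q(a := x)) j" if "j < m" for j using pq[OF that] by simp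
    qed blast
    have "a \<in> S'" using S'(2)[OF \<open>a \<in> S\<close> a(1)] by simp
    then have "S' \<in> \<W>" using S' by (simp add: \<W>_def demand_def)
    then have "indirect_utility m v (q(a := x)) \<le> A q - x"
      using S' A_ge[of S' q] sum_W[of S' q x] by (simp add: mem_demand_iff)
    then show False using x u[of q x] by simp
  qed
  have "indirect_utility m v p = max (A p - p a) (B p)"
    using u[of p "p a"] by simp
  moreover have "indirect_utility m v q = max (A q - p a) (B q)"
    using u[of q "q a"] a(2) by simp
  ultimately show ?thesis using u[of p t] u[of q t] threshold a(3) by (auto simp: max_def)
qed

text \<open>Raise the prices of \<open>J\<close> one item at a time: at each stage the two price
  vectors are still ordered and agree on the next item, so the one-item inequality applies, and the
  differences telescope.\<close>

lemma indirect_utility_decreasing_differences_override_on: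
  assumes v: "v \<in> GS m" and "finite J" "J \<subseteq> {..<m}"
    and pq: "\<And>j. j < m \<Longrightarrow> p j \<le> q j" and J: "\<And>j. j \<in> J \<Longrightarrow> p j = q j \<and> p j \<le> t j"
  shows "indirect_utility m v (override_on q t J) - indirect_utility m v q
    \<le> indirect_utility m v (override_on p t J) - indirect_utility m v p"
  using assms(2,3) J
proof (induction J rule: finite_induct)
  case empty
  then show ?case by simp
next
  case (insert a J)
  have IH: "indirect_utility m v (override_on q t J) - indirect_utility m v q
    \<le> indirect_utility m v (override_on p t J) - indirect_utility m v p"
    using insert.prems by (intro insert.IH) blast+
  have "indirect_utility m v ((override_on q t J)(a := t a)) - indirect_utility m v (override_on q t J)
    \<le> indirect_utility m v ((override_on p t J)(a := t a)) - indirect_utility m v (override_on p t J)"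
    using insert.hyps insert.prems(1) insert.prems(2)[of a] insert.prems(2) pq
    by (intro indirect_utility_decreasing_differences[OF v]) (auto simp: override_on_def)
  then show ?case using IH unfolding override_on_insert by linarith
qed

text \<open>The meet of \<open>p\<close> and \<open>q\<close> lies below \<open>q\<close> and equals
  it on the items \<open>J\<close> where \<open>p\<close> is larger. Raising the prices on
  \<open>J\<close> to those of \<open>p\<close> turns \<open>q\<close> into the join and the meet
  into \<open>p\<close>, so this is an instance of decreasing differences.\<close>

lemma indirect_utility_submodular:
  assumes v: "v \<in> GS m"
  shows "indirect_utility m v (\<lambda>j. max (p j) (q j)) + indirect_utility m v (\<lambda>j. min (p j) (q j))
    \<le> indirect_utility m v p + indirect_utility m v q"
proof -
  define J where "J = {j. j < m \<and> q j < p j}"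
  let ?l = "\<lambda>j. min (p j) (q j)"
  have "indirect_utility m v (override_on q p J) - indirect_utility m v q
    \<le> indirect_utility m v (override_on ?l p J) - indirect_utility m v ?l"
    by (intro indirect_utility_decreasing_differences_override_on[OF v]) (auto simp: J_def)
  moreover have "indirect_utility m v (override_on q p J) = indirect_utility m v (\<lambda>j. max (p j) (q j))"
    by (intro indirect_utility_cong) (auto simp: J_def override_on_def)
  moreover have "indirect_utility m v (override_on ?l p J) = indirect_utility m v p"
    by (intro indirect_utility_cong) (auto simp: J_def override_on_def)
  ultimately show ?thesis by linarith
qed

section \<open>Optimal welfare and its price dual\<close>

text \<open>Items of \<open>T\<close> may stay unassigned. \<open>PiE\<close> fixes the values
  outside \<open>I\<close>, which keeps the set finite for finite \<open>I\<close> and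
  \<open>T\<close>, as \<open>Max\<close> requires.\<close>

definition allocations :: "nat set \<Rightarrow> itemset \<Rightarrow> (nat \<Rightarrow> itemset) set" where
  "allocations I T = {X \<in> PiE I (\<lambda>_. Pow T). disjoint_family_on X I}"

definition opt_welfare :: "nat set \<Rightarrow> profile \<Rightarrow> itemset \<Rightarrow> real" where
  "opt_welfare I b T = Max ((\<lambda>X. \<Sum>i\<in>I. b i (X i)) ` allocations I T)"

lemma finite_allocations: "finite I \<Longrightarrow> finite T \<Longrightarrow> finite (allocations I T)"
  unfolding allocations_def by (rule finite_subset[of _ "PiE I (\<lambda>_. Pow T)"]) (auto intro: finite_PiE)

lemma opt_welfare_ge:
  assumes "finite I" "finite T" "\<And>i. i \<in> I \<Longrightarrow> X i \<subseteq> T" "disjoint_family_on X I"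
  shows "(\<Sum>i\<in>I. b i (X i)) \<le> opt_welfare I b T"
proof -
  have "restrict X I \<in> allocations I T"
    using assms by (auto simp: allocations_def disjoint_family_on_def)
  moreover have "(\<Sum>i\<in>I. b i (X i)) = (\<Sum>i\<in>I. b i (restrict X I i))"
    by (intro sum.cong) auto
  ultimately show ?thesis
    unfolding opt_welfare_def using finite_allocations[OF assms(1,2)]
    by (intro Max_ge finite_imageI image_eqI[of _ _ "restrict X I"])
qed

lemma opt_welfare_attained:
  assumes "finite I" "finite T"
  obtains X where "\<And>i. i \<in> I \<Longrightarrow> X i \<subseteq> T" "disjoint_family_on X I"
    "opt_welfare I b T = (\<Sum>i\<in>I. b i (X i))"
proof -
  have "(\<lambda>i\<in>I. {}) \<in> allocations I T"
    by (auto simp: allocations_def disjoint_family_on_def)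
  then have "opt_welfare I b T \<in> (\<lambda>X. \<Sum>i\<in>I. b i (X i)) ` allocations I T"
    unfolding opt_welfare_def using finite_allocations[OF assms] by (intro Max_in) auto
  then show thesis
    using that by (auto simp: allocations_def PiE_iff)
qed

text \<open>A Kelso-Crawford auction with price increment \<open>\<delta>\<close>. In a state, an item of \<open>T\<close> costs its
  current holder \<open>\<delta> * k j\<close> and everybody else one increment more; every agent holds part of a
  bundle demanded at her own prices. Items outside \<open>T\<close> are priced out of the market. Instead of
  running the auction we take a state with maximal total price: there nobody wants to take further
  items.\<close>

lemma opt_welfare_approx_duality:
  assumes I: "finite I" and b: "\<And>i. i \<in> I \<Longrightarrow> b i \<in> GS m" and T: "T \<subseteq> {..<m}" and \<epsilon>: "0 < \<epsilon>"
  obtains p where "\<And>j. 0 \<le> p j" "(\<Sum>i\<in>I. indirect_utility m (b i) p) + sum p T \<le> opt_welfare I b T + \<epsilon>"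
proof -
  \<comment> \<open>One increment of error per agent and item then adds up to at most
    \<open>\<epsilon>\<close>; the \<open>+ 1\<close> keeps the denominator positive when there are
    no agents or no items.\<close>
  define \<delta> where "\<delta> = \<epsilon> / (real (card I) * real m + 1)"
  have \<delta>: "0 < \<delta>" unfolding \<delta>_def using \<epsilon> by (intro divide_pos_pos) (auto simp: add_nonneg_pos)
  have "real (card I) * real m * \<delta> \<le> (real (card I) * real m + 1) * \<delta>"
    using \<delta> by (simp add: distrib_right)
  also have "\<dots> = \<epsilon>"
    unfolding \<delta>_def using add_nonneg_pos[of "real (card I) * real m" 1] by simp
  finally have \<delta>_\<epsilon>: "real (card I) * real m * \<delta> \<le> \<epsilon>" .
  have finT: "finite T" using T finite_subset by blast
  have val: "is_valuation m (b i)" if "i \<in> I" for i using GS_is_valuation b that by blast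
  \<comment> \<open>\<open>C\<close> exceeds every agent's value for all items, so no demanded
    bundle contains an item priced at \<open>C\<close> or above.\<close>
  define C where "C = (\<Sum>i\<in>I. b i {..<m}) + 1"
  have C: "b i {..<m} < C" if "i \<in> I" for i
  proof -
    have "b i {..<m} \<le> (\<Sum>i\<in>I. b i {..<m})"
      using I that val by (intro member_le_sum) (auto simp: is_valuation_def)
    then show ?thesis by (simp add: C_def)
  qed
  define P where "P k j = (if j \<in> T then \<delta> * real (k j) else C)" for k :: "nat \<Rightarrow> nat" and j
  define Q where "Q k S j = P k j + (if j \<in> S then 0 else \<delta>)" for k S j
  \<comment> \<open>The last clause is complementary slackness: an item that nobody holds still has
    price zero.\<close>
  define st where "st k X \<longleftrightarrow>
      (\<forall>i\<in>I. X i \<subseteq> T \<and> (\<exists>D\<in>demand m (b i) (Q k (X i)). X i \<subseteq> D)) \<and>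
      disjoint_family_on X I \<and> (\<forall>j. k j \<noteq> 0 \<longrightarrow> j \<in> (\<Union>i\<in>I. X i))" for k X
  have demand_T: "D \<subseteq> T" if "i \<in> I" "D \<in> demand m (b i) (Q k S)" for i D k S
  proof
    fix j assume "j \<in> D"
    then have "Q k S j < C" using demanded_price_le[OF val that(2)] C[of i] that by fastforce
    then show "j \<in> T" using \<delta> by (auto simp: Q_def P_def split: if_splits)
  qed
  \<comment> \<open>An item whose counter is positive has a holder, who pays less than
    \<open>C\<close> for it. The counters are therefore bounded over all states, and a state with
    maximal total exists.\<close>
  have bound: "k j \<le> nat \<lceil>C / \<delta>\<rceil>" if st: "st k X" and j: "j \<in> T" for k X j
  proof (cases "k j = 0")
    case False
    then obtain i where i: "i \<in> I" "j \<in> X i" using st unfolding st_def by blast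
    then obtain D where "D \<in> demand m (b i) (Q k (X i))" "X i \<subseteq> D"
      using st unfolding st_def by blast
    then have "Q k (X i) j < C" using demanded_price_le[OF val, of i D _ j] C[of i] i by fastforce
    then have "\<delta> * real (k j) < C" using i j by (simp add: Q_def P_def)
    then have "real (k j) \<le> C / \<delta>" using \<delta> by (simp add: field_simps)
    then show ?thesis by linarith
  qed simp
  have "st (\<lambda>_. 0) (\<lambda>_. {})"
    using demand_nonempty by (auto simp: st_def disjoint_family_on_def)
  moreover have "sum k T < Suc (card T * nat \<lceil>C / \<delta>\<rceil>)" if "st k X" for k X
    using sum_bounded_above[of T k "nat \<lceil>C / \<delta>\<rceil>"] bound[OF that] by simp
  ultimately have "\<exists>s. (\<lambda>(k, X). st k X) s \<and>
      (\<forall>s'. (\<lambda>(k, X). st k X) s' \<longrightarrow> sum (fst s') T \<le> sum (fst s) T)"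
    by (intro ex_has_greatest_nat[of _ "(\<lambda>_. 0, \<lambda>_. {})"]) auto
  then obtain k X where kX: "st k X" and max: "\<And>k' X'. st k' X' \<Longrightarrow> sum k' T \<le> sum k T"
    by auto
  have XT: "X i \<subseteq> T" if "i \<in> I" for i using kX that by (simp add: st_def)
  have disj: "disjoint_family_on X I" using kX by (simp add: st_def)
  have demanded: "X i \<in> demand m (b i) (Q k (X i))" if i: "i \<in> I" for i
  proof (rule ccontr)
    assume not: "X i \<notin> demand m (b i) (Q k (X i))"
    obtain D where D: "D \<in> demand m (b i) (Q k (X i))" "X i \<subseteq> D"
      using kX i by (auto simp: st_def)
    have DT: "D \<subseteq> T" using demand_T i D by blast
    \<comment> \<open>Hand all of \<open>D\<close> to \<open>i\<close> and raise the counters of the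
      items she takes over. This gives another state with a larger total.\<close>
    define k' where "k' j = (if j \<in> D - X i then k j + 1 else k j)" for j
    define X' where "X' h = (if h = i then D else X h - D)" for h
    have "\<exists>D'\<in>demand m (b h) (Q k' (X' h)). X' h \<subseteq> D'" if h: "h \<in> I" for h
    proof (cases "h = i")
      case True
      \<comment> \<open>The increment that \<open>i\<close> faced as a non-holder on
        \<open>D - X i\<close> has moved into the counters, so her own prices are unchanged.\<close>
      have "Q k' D = Q k (X i)"
        using D DT by (auto simp: Q_def P_def k'_def fun_eq_iff distrib_left)
      then show ?thesis using D True by (auto simp: X'_def)
    next
      case False
      then have X'h: "X' h = X h - D" by (simp add: X'_def)
      obtain E where E: "E \<in> demand m (b h) (Q k (X h))" "X h \<subseteq> E"
        using kX h by (auto simp: st_def)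
      \<comment> \<open>For the other agents prices only rise, and they stay the same on what they
        keep; gross substitutes preserves the demand for it.\<close>
      have "Q k (X h) j \<le> Q k' (X' h) j" for j
        unfolding X'h using \<delta> by (auto simp: Q_def P_def k'_def distrib_left)
      then obtain E' where E': "E' \<in> demand m (b h) (Q k' (X' h))"
        "\<And>j. j \<in> E \<Longrightarrow> j < m \<Longrightarrow> Q k (X h) j = Q k' (X' h) j \<Longrightarrow> j \<in> E'"
        using GS_substitutes[OF b[OF h] _ E(1), of "Q k' (X' h)"] by blast
      have "X' h \<subseteq> E'"
      proof
        fix j assume "j \<in> X' h"
        then show "j \<in> E'"
          using E XT[OF h] T by (intro E'(2)) (auto simp: X'h Q_def P_def k'_def)
      qed
      then show ?thesis using E' by blast
    qed
    moreover have "\<forall>h\<in>I. X' h \<subseteq> T" using DT XT by (auto simp: X'_def)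
    moreover have "disjoint_family_on X' I"
      using disj by (auto simp: X'_def disjoint_family_on_def)
    moreover have "j \<in> (\<Union>h\<in>I. X' h)" if "k' j \<noteq> 0" for j
    proof (cases "j \<in> D")
      case True
      then show ?thesis using i by (auto simp: X'_def)
    next
      case False
      then have "k j \<noteq> 0" using that by (simp add: k'_def)
      then obtain h where "h \<in> I" "j \<in> X h" using kX unfolding st_def by blast
      then show ?thesis using False D by (auto simp: X'_def)
    qed
    ultimately have "st k' X'" by (simp add: st_def)
    moreover obtain j where "j \<in> D - X i" using D not by (metis Diff_eq_empty_iff equals0I subset_antisym)
    then have "sum k T < sum k' T"
      using finT DT by (intro sum_strict_mono_ex1) (auto simp: k'_def intro!: bexI[of _ j])
    ultimately show False using max[of k' X'] by simp
  qed
  have "(\<Sum>i\<in>I. indirect_utility m (b i) (P k)) + sum (P k) T \<le> opt_welfare I b T + \<epsilon>"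
  proof -
    have "indirect_utility m (b i) (P k) \<le> b i (X i) - sum (P k) (X i) + real m * \<delta>"
      if i: "i \<in> I" for i
    proof -
      obtain S where S: "S \<subseteq> {..<m}" "indirect_utility m (b i) (P k) = b i S - sum (P k) S"
        by (rule indirect_utility_attained)
      \<comment> \<open>The personal prices exceed the common ones by at most
        \<open>\<delta>\<close> per item, so \<open>X i\<close> is optimal at \<open>P k\<close> up
        to \<open>real m * \<delta>\<close>.\<close>
      have "sum (Q k (X i)) S \<le> (\<Sum>j\<in>S. P k j + \<delta>)"
        using \<delta> by (intro sum_mono) (auto simp: Q_def)
      also have "\<dots> = sum (P k) S + real (card S) * \<delta>" by (simp add: sum.distrib)
      also have "\<dots> \<le> sum (P k) S + real m * \<delta>"
        using \<delta> card_mono[OF _ S(1)] by simp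
      finally have "sum (Q k (X i)) S \<le> sum (P k) S + real m * \<delta>" .
      moreover have "b i S - sum (Q k (X i)) S \<le> b i (X i) - sum (Q k (X i)) (X i)"
        using demanded[OF i] S by (simp add: demand_def)
      moreover have "sum (Q k (X i)) (X i) = sum (P k) (X i)"
        by (intro sum.cong) (auto simp: Q_def)
      ultimately show ?thesis using S by linarith
    qed
    then have "(\<Sum>i\<in>I. indirect_utility m (b i) (P k))
        \<le> (\<Sum>i\<in>I. b i (X i) - sum (P k) (X i) + real m * \<delta>)"
      by (intro sum_mono) simp
    also have "\<dots> = (\<Sum>i\<in>I. b i (X i)) - (\<Sum>i\<in>I. sum (P k) (X i)) + real (card I) * real m * \<delta>"
      by (simp add: sum.distrib sum_subtractf)
    also have "(\<Sum>i\<in>I. sum (P k) (X i)) = sum (P k) (\<Union>i\<in>I. X i)"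
      using I disj finite_subset[OF XT finT]
      by (intro sum.UNION_disjoint[symmetric]) (auto simp: disjoint_family_on_def)
    \<comment> \<open>Unheld items of \<open>T\<close> have counter zero and hence contribute
      nothing.\<close>
    also have "\<dots> = sum (P k) T"
      using finT XT kX by (intro sum.mono_neutral_left) (auto simp: st_def P_def)
    finally show ?thesis
      using \<delta>_\<epsilon> opt_welfare_ge[OF I finT XT disj, of b] by linarith
  qed
  moreover have "0 \<le> C"
    unfolding C_def using val by (intro add_nonneg_nonneg sum_nonneg) (auto simp: is_valuation_def)
  then have "0 \<le> P k j" for j using \<delta> by (simp add: P_def)
  ultimately show thesis using that by blast
qed

text \<open>Weak duality: at an optimal allocation each agent's net value is at most her indirect
  utility, and the nonnegative prices of the allocated items sum to at most
  \<open>sum p T\<close>.\<close>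

lemma opt_welfare_le_dual:
  assumes I: "finite I" and T: "T \<subseteq> {..<m}" and p: "\<And>j. 0 \<le> p j"
  shows "opt_welfare I b T \<le> (\<Sum>i\<in>I. indirect_utility m (b i) p) + sum p T"
proof -
  have finT: "finite T" using T finite_subset by blast
  obtain X where X: "\<And>i. i \<in> I \<Longrightarrow> X i \<subseteq> T" "disjoint_family_on X I"
    "opt_welfare I b T = (\<Sum>i\<in>I. b i (X i))"
    using opt_welfare_attained[OF I finT] by blast
  have "(\<Sum>i\<in>I. b i (X i) - sum p (X i)) \<le> (\<Sum>i\<in>I. indirect_utility m (b i) p)"
    using X T by (intro sum_mono indirect_utility_ge) blast
  moreover have "(\<Sum>i\<in>I. sum p (X i)) = sum p (\<Union>i\<in>I. X i)"
    using I X(2) finite_subset[OF X(1) finT]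
    by (intro sum.UNION_disjoint[symmetric]) (auto simp: disjoint_family_on_def)
  moreover have "\<dots> \<le> sum p T"
    using X finT p by (intro sum_mono2) auto
  ultimately show ?thesis using X by (simp add: sum_subtractf)
qed

section \<open>Submodularity of the optimal welfare and its consequences for losses of items\<close>

text \<open>Take nearly optimal dual prices \<open>p\<close> for \<open>A\<close> and
  \<open>q\<close> for \<open>B\<close>, and use their meet as dual prices for the union and their
  join for the intersection. The indirect utilities are submodular, and the price sums compare item
  by item.\<close>

lemma opt_welfare_submodular:
  assumes I: "finite I" and b: "\<And>i. i \<in> I \<Longrightarrow> b i \<in> GS m" and A: "A \<subseteq> {..<m}" and B: "B \<subseteq> {..<m}"
  shows "opt_welfare I b (A \<union> B) + opt_welfare I b (A \<inter> B) \<le> opt_welfare I b A + opt_welfare I b B"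
proof (rule field_le_epsilon)
  fix \<epsilon> :: real assume "0 < \<epsilon>"
  then have \<epsilon>: "0 < \<epsilon> / 2" by simp
  let ?U = "\<lambda>p. \<Sum>i\<in>I. indirect_utility m (b i) p"
  obtain p where p: "\<And>j. 0 \<le> p j" "?U p + sum p A \<le> opt_welfare I b A + \<epsilon> / 2"
    using opt_welfare_approx_duality[of I b m A, OF I _ A \<epsilon>] b by blast
  obtain q where q: "\<And>j. 0 \<le> q j" "?U q + sum q B \<le> opt_welfare I b B + \<epsilon> / 2"
    using opt_welfare_approx_duality[of I b m B, OF I _ B \<epsilon>] b by blast
  let ?l = "\<lambda>j. min (p j) (q j)" and ?h = "\<lambda>j. max (p j) (q j)"
  have fin: "finite A" "finite B" using A B finite_subset by blast+
  have "?U ?h + ?U ?l \<le> ?U p + ?U q"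
    unfolding sum.distrib[symmetric] by (intro sum_mono indirect_utility_submodular b)
  moreover have "sum ?l (A \<union> B) + sum ?h (A \<inter> B) \<le> sum p A + sum q B"
  proof -
    have "A \<union> B = (A - B) \<union> (B - A) \<union> (A \<inter> B)" by blast
    then have "sum ?l (A \<union> B) = sum ?l ((A - B) \<union> (B - A) \<union> (A \<inter> B))" by simp
    also have "\<dots> = sum ?l (A - B) + sum ?l (B - A) + sum ?l (A \<inter> B)"
      using fin by (subst sum.union_disjoint; (subst sum.union_disjoint)?) auto
    finally have "sum ?l (A \<union> B) + sum ?h (A \<inter> B)
        = sum ?l (A - B) + sum ?l (B - A) + (\<Sum>j\<in>A \<inter> B. ?l j + ?h j)"
      by (simp add: sum.distrib)
    also have "(\<Sum>j\<in>A \<inter> B. ?l j + ?h j) = (\<Sum>j\<in>A \<inter> B. p j + q j)"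
      by (intro sum.cong) auto
    also have "\<dots> = sum p (A \<inter> B) + sum q (A \<inter> B)" by (rule sum.distrib)
    also have "sum ?l (A - B) \<le> sum p (A - B)" by (intro sum_mono) simp
    also have "sum ?l (B - A) \<le> sum q (B - A)" by (intro sum_mono) simp
    also have "sum p (A - B) + sum q (B - A) + (sum p (A \<inter> B) + sum q (A \<inter> B)) = sum p A + sum q B"
      using fin sum.Int_Diff[of A p B] sum.Int_Diff[of B q A] by (simp add: Int_commute)
    finally show ?thesis by simp
  qed
  moreover have "opt_welfare I b (A \<union> B) \<le> ?U ?l + sum ?l (A \<union> B)"
    using A B p q by (intro opt_welfare_le_dual I) auto
  moreover have "opt_welfare I b (A \<inter> B) \<le> ?U ?h + sum ?h (A \<inter> B)"
    using A p q by (intro opt_welfare_le_dual I) (auto simp: le_max_iff_disj)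
  ultimately show "opt_welfare I b (A \<union> B) + opt_welfare I b (A \<inter> B)
      \<le> opt_welfare I b A + opt_welfare I b B + \<epsilon>"
    using p q by linarith
qed

text \<open>Fix the bundle \<open>X i\<close> that \<open>i\<close> gets when \<open>S\<close> is
  missing and let her keep it when \<open>S\<close> is present. The loss of all agents is then at
  least the loss of the others when they start from the items outside \<open>X i\<close>. As
  \<open>X i\<close> avoids \<open>S\<close>, submodularity bounds this below by their loss from all
  items.\<close>

lemma opt_welfare_item_loss_mono_agents:
  assumes I: "finite I" and b: "\<And>i. i \<in> I \<Longrightarrow> b i \<in> GS m" and i: "i \<in> I" and S: "S \<subseteq> {..<m}"
  shows "opt_welfare (I - {i}) b {..<m} - opt_welfare (I - {i}) b ({..<m} - S)
    \<le> opt_welfare I b {..<m} - opt_welfare I b ({..<m} - S)"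
proof -
  let ?M = "{..<m}" and ?J = "I - {i}"
  obtain X where X: "\<And>k. k \<in> I \<Longrightarrow> X k \<subseteq> ?M - S" "disjoint_family_on X I"
    "opt_welfare I b (?M - S) = (\<Sum>k\<in>I. b k (X k))"
    using opt_welfare_attained[OF I, of "?M - S"] by blast
  have "(\<Sum>k\<in>?J. b k (X k)) \<le> opt_welfare ?J b (?M - S - X i)"
  proof (rule opt_welfare_ge)
    show "X k \<subseteq> ?M - S - X i" if "k \<in> ?J" for k
      using that X(1)[of k] X(2) i by (auto simp: disjoint_family_on_def)
    show "disjoint_family_on X ?J"
      using X(2) by (auto simp: disjoint_family_on_def)
  qed (use I in auto)
  moreover have "opt_welfare I b (?M - S) = b i (X i) + (\<Sum>k\<in>?J. b k (X k))"
    using X(3) I i by (simp add: sum.remove)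
  moreover have "b i (X i) + opt_welfare ?J b (?M - X i) \<le> opt_welfare I b ?M"
  proof -
    obtain Y where Y: "\<And>k. k \<in> ?J \<Longrightarrow> Y k \<subseteq> ?M - X i" "disjoint_family_on Y ?J"
      "opt_welfare ?J b (?M - X i) = (\<Sum>k\<in>?J. b k (Y k))"
      using opt_welfare_attained[of ?J "?M - X i" b] I by blast
    let ?Z = "Y(i := X i)"
    have "(\<Sum>k\<in>I. b k (?Z k)) \<le> opt_welfare I b ?M"
    proof (rule opt_welfare_ge)
      show "?Z k \<subseteq> ?M" if "k \<in> I" for k
        using that X(1)[OF i] Y(1)[of k] by auto
      have "Y k \<inter> X i = {}" if "k \<in> I" "k \<noteq> i" for k
        using Y(1)[of k] that by blast
      then show "disjoint_family_on ?Z I"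
        using Y(2) unfolding disjoint_family_on_def
        by (metis DiffI Int_commute fun_upd_apply singletonD)
    qed (use I in auto)
    also have "(\<Sum>k\<in>I. b k (?Z k)) = b i (X i) + (\<Sum>k\<in>?J. b k (?Z k))"
      using I i by (simp add: sum.remove)
    also have "(\<Sum>k\<in>?J. b k (?Z k)) = (\<Sum>k\<in>?J. b k (Y k))"
      by (intro sum.cong) auto
    finally show ?thesis using Y(3) by simp
  qed
  moreover have "opt_welfare ?J b ?M + opt_welfare ?J b (?M - S - X i)
      \<le> opt_welfare ?J b (?M - X i) + opt_welfare ?J b (?M - S)"
  proof -
    have "(?M - X i) \<union> (?M - S) = ?M" "(?M - X i) \<inter> (?M - S) = ?M - S - X i"
      using X(1)[OF i] by auto
    then show ?thesis
      using opt_welfare_submodular[of ?J b m "?M - X i" "?M - S"] I b by auto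
  qed
  ultimately show ?thesis by linarith
qed

text \<open>Remove the disjoint bundles one after another. By submodularity each costs at least as
  much after the earlier removals as when taken from the full set.\<close>

lemma opt_welfare_sum_item_losses_le:
  assumes I: "finite I" and b: "\<And>i. i \<in> I \<Longrightarrow> b i \<in> GS m"
    and "finite K" "\<And>i. i \<in> K \<Longrightarrow> S i \<subseteq> {..<m}" "disjoint_family_on S K"
  shows "(\<Sum>i\<in>K. opt_welfare I b {..<m} - opt_welfare I b ({..<m} - S i))
    \<le> opt_welfare I b {..<m} - opt_welfare I b ({..<m} - (\<Union>i\<in>K. S i))"
  using assms(3-5)
proof (induction K rule: finite_induct)
  case empty
  then show ?case by simp
next
  case (insert k K)
  let ?M = "{..<m}"
  have "disjoint_family_on S K" "\<And>i. i \<in> K \<Longrightarrow> S i \<subseteq> ?M"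
    using insert.prems by (auto simp: disjoint_family_on_def)
  note IH = insert.IH[OF this(2,1)]
  have "S k \<inter> (\<Union>i\<in>K. S i) = {}"
    using insert.prems(2) insert.hyps(2) by (force simp: disjoint_family_on_def)
  then have "(?M - S k) \<union> (?M - (\<Union>i\<in>K. S i)) = ?M"
    by blast
  moreover have "(?M - S k) \<inter> (?M - (\<Union>i\<in>K. S i)) = ?M - (\<Union>i\<in>insert k K. S i)" by auto
  ultimately have "opt_welfare I b ?M + opt_welfare I b (?M - (\<Union>i\<in>insert k K. S i))
      \<le> opt_welfare I b (?M - S k) + opt_welfare I b (?M - (\<Union>i\<in>K. S i))"
    using  opt_welfare_submodular[of I b m "?M - S k" "?M - (\<Union>i\<in>K. S i)"] I b by auto
  then show ?case using IH insert.hyps by simp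
qed

section \<open>Declared optimality, deviations and the welfare bound\<close>

text \<open>Optimality is stated against partitions only. Giving the unassigned items to agent
  \<open>0\<close> completes \<open>X\<close> to a partition, and monotonicity keeps the welfare
  from falling.\<close>

lemma disjoint_allocation_le_optimal_partition:
  assumes opt: "optimal_partition m n b Y" and b: "\<And>i. i < n \<Longrightarrow> is_valuation m (b i)"
    and X: "\<And>i. i < n \<Longrightarrow> X i \<subseteq> {..<m}" "disjoint_family_on X {..<n}"
  shows "welfare n b X \<le> welfare n b Y"
proof (cases "n = 0")
  case True
  then show ?thesis by (simp add: welfare_def)
next
  case False
  define Z where "Z i = (if i = 0 then X 0 \<union> ({..<m} - (\<Union>i<n. X i)) else X i)" for i
  have Z: "Z i \<subseteq> {..<m}" if "i < n" for i using X(1)[OF that] by (auto simp: Z_def)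
  have "is_partition m n Z"
    unfolding is_partition_def
  proof (intro conjI allI impI)
    fix i k assume ik: "i < n" "k < n" "i \<noteq> k"
    then have "X i \<inter> X k = {}" using X(2) by (simp add: disjoint_family_on_def)
    moreover have "X h \<inter> ({..<m} - (\<Union>i<n. X i)) = {}" if "h < n" for h using that by blast
    ultimately show "Z i \<inter> Z k = {}"
      using ik unfolding Z_def by (auto simp: Int_Un_distrib Int_Un_distrib2 Int_commute)
  next
    show "(\<Union>i<n. Z i) = {..<m}"
    proof
      show "(\<Union>i<n. Z i) \<subseteq> {..<m}" using Z by blast
      show "{..<m} \<subseteq> (\<Union>i<n. Z i)"
      proof
        fix j assume j: "j \<in> {..<m}"
        show "j \<in> (\<Union>i<n. Z i)"
        proof (cases "j \<in> (\<Union>i<n. X i)")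
          case True
          then obtain i where i: "i < n" "j \<in> X i" by blast
          have "X i \<subseteq> Z i" by (auto simp: Z_def)
          with i show ?thesis by blast
        next
          case False
          then have "j \<in> Z 0" using j by (simp add: Z_def)
          then show ?thesis using \<open>n \<noteq> 0\<close> by blast
        qed
      qed
    qed
  qed (rule Z)
  then have "welfare n b Z \<le> welfare n b Y" using opt by (simp add: optimal_partition_def)
  moreover have "welfare n b X \<le> welfare n b Z"
    unfolding welfare_def
  proof (rule sum_mono)
    fix i assume i: "i \<in> {..<n}"
    have "X i \<subseteq> Z i" by (auto simp: Z_def)
    then show "b i (X i) \<le> b i (Z i)" using b[of i] Z[of i] i by (auto simp: is_valuation_def)
  qed
  ultimately show ?thesis by linarith
qed

lemma optimal_partition_disjoint:
  assumes "optimal_partition m n b Y"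
  shows "i < n \<Longrightarrow> Y i \<subseteq> {..<m}" "disjoint_family_on Y {..<n}"
  using assms by (auto simp: optimal_partition_def is_partition_def disjoint_family_on_def)

text \<open>Bidding half her value, \<open>i\<close> pays at most half the value of her bundle
  \<open>Y i\<close> and keeps the other half. Declared optimality of \<open>Y\<close> is compared
  with giving \<open>S\<close> to \<open>i\<close> and the remaining items optimally to the
  others.\<close>

lemma half_value_deviation:
  assumes mech: "declared_welfare_maximizer m n alloc pay"
    and v: "v i \<in> GS m" and nash: "pure_nash m n alloc pay v b" and i: "i < n" and S: "S \<subseteq> {..<m}"
  shows "v i S / 2 - (opt_welfare ({..<n} - {i}) b {..<m} - opt_welfare ({..<n} - {i}) b ({..<m} - S))
    \<le> utility alloc pay (v i) i b"
proof -
  let ?M = "{..<m}" and ?J = "{..<n} - {i}"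
  define w where "w = (\<lambda>S. 1/2 * v i S)"
  define b' where "b' = b(i := w)"
  have w: "w \<in> GS m" unfolding w_def by (rule scale_mem_GS[OF v]) simp
  have valid: "valid_profile m n b'"
    using nash w by (auto simp: pure_nash_def valid_profile_def b'_def)
  define Y where "Y = alloc b'"
  have opt: "optimal_partition m n b' Y" and pay: "pay b' i \<le> b' i (Y i)"
    using mech valid i unfolding declared_welfare_maximizer_def Y_def by blast+
  obtain X where X: "\<And>k. k \<in> ?J \<Longrightarrow> X k \<subseteq> ?M - S" "disjoint_family_on X ?J"
    "opt_welfare ?J b (?M - S) = (\<Sum>k\<in>?J. b k (X k))"
    using opt_welfare_attained[of ?J "?M - S" b] by blast
  have split: "welfare n b' Z = w (Z i) + (\<Sum>k\<in>?J. b k (Z k))" for Z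
  proof -
    have "welfare n b' Z = b' i (Z i) + (\<Sum>k\<in>?J. b' k (Z k))"
      unfolding welfare_def using i by (intro sum.remove) auto
    moreover have "(\<Sum>k\<in>?J. b' k (Z k)) = (\<Sum>k\<in>?J. b k (Z k))"
      by (intro sum.cong) (auto simp: b'_def)
    ultimately show ?thesis by (simp add: b'_def)
  qed
  have "welfare n b' (X(i := S)) \<le> welfare n b' Y"
  proof (rule disjoint_allocation_le_optimal_partition[OF opt])
    show "is_valuation m (b' k)" if "k < n" for k
      using valid that by (auto simp: valid_profile_def intro: GS_is_valuation)
    show "(X(i := S)) k \<subseteq> ?M" if "k < n" for k
      using that X(1)[of k] S by auto
    have "X k \<inter> S = {}" if "k < n" "k \<noteq> i" for k
      using X(1)[of k] that by blast
    then show "disjoint_family_on (X(i := S)) {..<n}"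
      using X(2) unfolding disjoint_family_on_def
      by (metis DiffI Int_commute fun_upd_apply lessThan_iff singletonD)
  qed
  moreover have "(\<Sum>k\<in>?J. b k ((X(i := S)) k)) = opt_welfare ?J b (?M - S)"
    unfolding X(3) by (intro sum.cong) auto
  moreover have "(\<Sum>k\<in>?J. b k (Y k)) \<le> opt_welfare ?J b ?M"
    using optimal_partition_disjoint[OF opt]
    by (intro opt_welfare_ge) (auto simp: disjoint_family_on_def)
  ultimately have "w S + opt_welfare ?J b (?M - S) \<le> w (Y i) + opt_welfare ?J b ?M"
    by (simp add: split)
  moreover have "v i (Y i) - pay b' i \<le> utility alloc pay (v i) i b"
    using nash i w by (auto simp: pure_nash_def b'_def Y_def utility_def)
  ultimately show ?thesis using pay by (simp add: b'_def w_def)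
qed

theorem theorem1:
  fixes m n :: nat and alloc :: "profile \<Rightarrow> nat \<Rightarrow> itemset" and pay :: "profile \<Rightarrow> nat \<Rightarrow> real"
    and \<gamma> :: real and v b :: profile and Xopt :: "nat \<Rightarrow> itemset"
  assumes "declared_welfare_maximizer m n alloc pay"
    and "0 \<le> \<gamma>"
    and "\<forall>i<n. v i \<in> GS m"
    and "pure_nash m n alloc pay v b"
    and "\<forall>i<n. has_exposure m n alloc pay \<gamma> (v i) i (b i)"
    and "optimal_partition m n v Xopt"
  shows "welfare n v Xopt \<le> (4 + 2 * \<gamma>) * welfare n v (alloc b)"
proof -
  let ?M = "{..<m}" and ?N = "{..<n}"
  note mech = assms(1)[unfolded declared_welfare_maximizer_def, rule_format]
  have valid: "valid_profile m n b" using assms(4) by (simp add: pure_nash_def)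
  then have b: "b i \<in> GS m" if "i \<in> ?N" for i using that by (simp add: valid_profile_def)
  have opt: "optimal_partition m n b (alloc b)" using mech[OF valid] by simp
  have exposure: "b i (alloc b i) \<le> (1 + \<gamma>) * v i (alloc b i)" if i: "i < n" for i
  proof -
    \<comment> \<open>At \<open>b'\<close> agent \<open>i\<close> wins the same bundle and pays her
      full bid for it, so the exposure bound on payments becomes a bound on the bid.\<close>
    obtain b' where "valid_profile m n b'" "b' i = b i" "alloc b' i = alloc b i"
      "pay b' i = b i (alloc b i)"
      using mech[OF valid] i by blast
    then show ?thesis using assms(5) i unfolding has_exposure_def by metis
  qed
  have "opt_welfare ?N b ?M \<le> welfare n b (alloc b)"
  proof -
    obtain X where X: "\<And>k. k \<in> ?N \<Longrightarrow> X k \<subseteq> ?M" "disjoint_family_on X ?N"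
      "opt_welfare ?N b ?M = (\<Sum>k\<in>?N. b k (X k))"
      using opt_welfare_attained[of ?N ?M b] by blast
    then show ?thesis
      using disjoint_allocation_le_optimal_partition[OF opt, of X] b GS_is_valuation
      by (simp add: welfare_def)
  qed
  also have "\<dots> \<le> (\<Sum>i<n. (1 + \<gamma>) * v i (alloc b i))"
    unfolding welfare_def using exposure by (intro sum_mono) simp
  finally have declared: "opt_welfare ?N b ?M \<le> (1 + \<gamma>) * welfare n v (alloc b)"
    by (simp add: welfare_def sum_distrib_left)

  let ?loss = "\<lambda>I i. opt_welfare I b ?M - opt_welfare I b (?M - Xopt i)"
  have Xopt: "Xopt i \<subseteq> ?M" if "i < n" for i
    using optimal_partition_disjoint[OF assms(6)] that by blast
  have "(\<Sum>i<n. v i (Xopt i) / 2 - ?loss ?N i) \<le> (\<Sum>i<n. v i (alloc b i))"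
  proof (rule sum_mono)
    fix i assume "i \<in> {..<n}"
    then have i: "i < n" by simp
    have "v i (Xopt i) / 2 - ?loss (?N - {i}) i \<le> utility alloc pay (v i) i b"
      using half_value_deviation[OF assms(1) _ assms(4) i Xopt[OF i]] assms(3) i by blast
    moreover have "?loss (?N - {i}) i \<le> ?loss ?N i"
      using i b Xopt by (intro opt_welfare_item_loss_mono_agents) auto
    moreover have "utility alloc pay (v i) i b \<le> v i (alloc b i)"
      using mech[OF valid] i by (simp add: utility_def)
    ultimately show "v i (Xopt i) / 2 - ?loss ?N i \<le> v i (alloc b i)" by linarith
  qed
  then have "welfare n v Xopt / 2 - (\<Sum>i<n. ?loss ?N i) \<le> welfare n v (alloc b)"
    by (simp add: welfare_def sum_subtractf sum_divide_distrib)
  moreover have "(\<Sum>i<n. ?loss ?N i) \<le> opt_welfare ?N b ?M - opt_welfare ?N b (?M - (\<Union>i<n. Xopt i))"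
    using optimal_partition_disjoint[OF assms(6)] b
    by (intro opt_welfare_sum_item_losses_le) auto
  moreover have "0 \<le> opt_welfare ?N b (?M - (\<Union>i<n. Xopt i))"
  proof -
    have "(\<Sum>i<n. b i {}) \<le> opt_welfare ?N b (?M - (\<Union>i<n. Xopt i))"
      by (rule opt_welfare_ge[of _ _ "\<lambda>_. {}"]) (auto simp: disjoint_family_on_def)
    moreover have "(\<Sum>i<n. b i {}) = 0"
      using b GS_is_valuation by (intro sum.neutral) (auto simp: is_valuation_def)
    ultimately show ?thesis by linarith
  qed
  \<comment> \<open>Half the optimal welfare is at most \<open>1 + (1 + \<gamma>)\<close> times the
    equilibrium welfare; doubling gives the factor \<open>4 + 2 * \<gamma>\<close>.\<close>
  ultimately show ?thesis using declared by (simp add: algebra_simps)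
qed

end
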